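(* Let $n\ge 2$ be even and let $\mathcal A\subseteq\mathcal K_2$ be a set of convex bodies in $\mathbb R^2$ closed under taking positive linear combinations (i.e. $\lambda K+\mu L\in\mathcal A$ whenever $K,L\in\mathcal A$ and $\lambda,\mu>0$, with Minkowski addition and scaling). Then for every $x\in\mathbb R_{>0}^{\binom{n}{2}}$ we have $x\in\mathcal{PV}(n,\mathcal A)$ if and only if $\varphi(x)\in\varphi(\mathcal{PV}(n,\mathcal A))$.
   Context: $\mathcal K_2$ is the set of non-empty compact convex subsets of $\mathbb R^2$, and $\mathrm V(K,L)$ denotes the mixed volume (mixed area) of $K,L\in\mathcal K_2$. Coordinates of $\mathbb R^{\binom{n}{2}}$ are indexed by the 2-element subsets $I=\{i,j\}\subseteq[n]=\{1,\dots,n\}$. For $K=(K_1,\dots,K_n)\in\mathcal A^n$ let $\mathrm{PV}(K)=(\mathrm V(K_i,K_j))_{\{i,j\}\subseteq[n]}\in\mathbb R^{\binom n2}$, and let the pure mixed volume configuration space be $\mathcal{PV}(n,\mathcal A)=\{\mathrm{PV}(K): K\in\mathcal A^n\}$. The partition monomial map is $\varphi:\mathbb R^{\binom n2}\to\mathbb R^N$, $\varphi(x)=(x_{I_1}x_{I_2}\cdots x_{I_{n/2}})_{I_1|\cdots|I_{n/2}}$, where the index runs over all partitions $I_1|\cdots|I_{n/2}$ of $[n]$ into 2-element subsets and $N$ is the number of such partitions. (Thus $\varphi(\mathcal{PV}(n,\mathcal A))$ is the set of vectors $(\mathrm V_{I_1}(K)\cdots\mathrm V_{I_{n/2}}(K))$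 over $K\in\mathcal A^n$.) *)

theory Defs
  imports "HOL-Analysis.Analysis"
begin

definition K2 :: "(real^2) set set" where
  "K2 = {K. K \<noteq> {} \<and> compact K \<and> convex K}"

definition msum :: "(real^2) set \<Rightarrow> (real^2) set \<Rightarrow> (real^2) set" where
  "msum K L = {x + y | x y. x \<in> K \<and> y \<in> L}"

definition mscale :: "real \<Rightarrow> (real^2) set \<Rightarrow> (real^2) set" where
  "mscale t K = (\<lambda>x. t *\<^sub>R x) ` K"

text \<open>Mixed area, via polarization of the area (Lebesgue measure):
  V(K,L) = (vol(K+L) - vol K - vol L)/2, so that V(K,K) = vol K.\<close>
definition mixed_vol :: "(real^2) set \<Rightarrow> (real^2) set \<Rightarrow> real" where
  "mixed_vol K L = (measure lebesgue (msum K L) - measure lebesgue K - measure lebesgue L) / 2"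

text \<open>2-element subsets of [n] = {1..n}: the index set of \<open>\<real>^(n choose 2)\<close>.\<close>
definition pairs :: "nat \<Rightarrow> nat set set" where
  "pairs n = {I. I \<subseteq> {1..n} \<and> card I = 2}"

text \<open>Vectors in \<open>\<real>^(n choose 2)\<close> are functions on \<open>pairs n\<close>, extended by 0.\<close>
definition PV :: "nat \<Rightarrow> (nat \<Rightarrow> (real^2) set) \<Rightarrow> (nat set \<Rightarrow> real)" where
  "PV n K = (\<lambda>I. if I \<in> pairs n then mixed_vol (K (Min I)) (K (Max I)) else 0)"

definition PVspace :: "nat \<Rightarrow> (real^2) set set \<Rightarrow> (nat set \<Rightarrow> real) set" where
  "PVspace n A = {PV n K | K. \<forall>i\<in>{1..n}. K i \<in> A}"

definition pair_partitions :: "nat \<Rightarrow> nat set set set" where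
  "pair_partitions n = {P. P \<subseteq> pairs n \<and> \<Union>P = {1..n} \<and>
      (\<forall>I\<in>P. \<forall>J\<in>P. I \<noteq> J \<longrightarrow> I \<inter> J = {})}"

text \<open>Partition monomial map; vectors in \<open>\<real>^N\<close> are functions on \<open>pair_partitions n\<close>, extended by 0.\<close>
definition phi :: "nat \<Rightarrow> (nat set \<Rightarrow> real) \<Rightarrow> (nat set set \<Rightarrow> real)" where
  "phi n x = (\<lambda>P. if P \<in> pair_partitions n then (\<Prod>I\<in>P. x I) else 0)"

end

theory Submission
  imports Defs
begin

text \<open>
  If \<open>\<phi>(x) = \<phi>(y)\<close> with \<open>x > 0\<close> and \<open>y = PV(K)\<close>, then \<open>y > 0\<close>, since mixed areas are nonnegative and every
  pair lies in some partition. The ratios \<open>w = x / y\<close> multiply to 1 over every partition into pairs;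
  exchanging two blocks gives \<open>w\<^sub>i\<^sub>j w\<^sub>k\<^sub>l = w\<^sub>i\<^sub>k w\<^sub>j\<^sub>l\<close>, hence \<open>w\<^sub>i\<^sub>j = c\<^sub>i c\<^sub>j\<close>, and the bodies \<open>c\<^sub>i K\<^sub>i\<close> realize \<open>x\<close>.

  This uses \<open>V(aK, bL) = a b V(K, L)\<close>, which follows from
  \<open>area(2K + L) + area L = 2 area(K + L) + 2 area K\<close>: applied to \<open>hL\<close> and \<open>K + sL\<close> it says that
  \<open>t \<mapsto> V(K, tL)\<close> is additive, and it is nonnegative. The identity is additive under cutting \<open>K\<close> by a line,
  so it reduces to triangles by approximation with polygons and cutting along diagonals.
  The doubled triangle \<open>2T\<close> is cut by its midlines into three translates of \<open>T\<close> and one of \<open>-T\<close>. Therefore the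
  part of \<open>area(T + L)\<close> odd under \<open>T \<mapsto> -T\<close> doubles along with \<open>T\<close>, while the defect of the even part gets
  multiplied by 4, which its linear growth in the size of \<open>T\<close> forbids unless it vanishes.
\<close>

section \<open>Minkowski sums and area\<close>

abbreviation area :: "(real^2) set \<Rightarrow> real" where
  "area \<equiv> measure lebesgue"

lemma msumI: "x \<in> K \<Longrightarrow> y \<in> L \<Longrightarrow> x + y \<in> msum K L"
  by (auto simp: msum_def)

lemma msumE:
  assumes "z \<in> msum K L"
  obtains x y where "x \<in> K" "y \<in> L" "z = x + y"
  using assms by (auto simp: msum_def)

lemma msum_mono: "K \<subseteq> K' \<Longrightarrow> L \<subseteq> L' \<Longrightarrow> msum K L \<subseteq> msum K' L'"
  by (auto simp: msum_def)

lemma msum_commute: "msum K L = msum L K"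
  by (auto simp: msum_def) (metis add.commute)+

lemma msum_assoc: "msum (msum K L) M = msum K (msum L M)"
  by (auto simp: msum_def) (metis add.assoc)+

lemma msum_zero_right [simp]: "msum K {0} = K"
  by (auto simp: msum_def)

lemma msum_translation_left: "msum ((\<lambda>x. a + x) ` K) L = (\<lambda>x. a + x) ` msum K L"
proof -
  have "msum ((\<lambda>x. a + x) ` K) L = msum {a} (msum K L)"
    unfolding msum_assoc[symmetric] by (auto simp: msum_def)
  then show ?thesis by (auto simp: msum_def)
qed

lemma area_translation [simp]: "area ((\<lambda>x. a + x) ` K) = area K"
  by (rule measure_translation)

lemma compact_msum: "compact K \<Longrightarrow> compact L \<Longrightarrow> compact (msum K L)"
  unfolding msum_def by (rule compact_sums)

lemma convex_msum:
  assumes "convex K" "convex L"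
  shows "convex (msum K L)"
proof -
  have "msum K L = (\<Union>x\<in>K. \<Union>y\<in>L. {x + y})" by (auto simp: msum_def)
  then show ?thesis using convex_sums[OF assms] by simp
qed

lemma compact_mscale: "compact K \<Longrightarrow> compact (mscale t K)"
  unfolding mscale_def by (rule compact_scaling)

lemma convex_mscale: "convex K \<Longrightarrow> convex (mscale t K)"
  unfolding mscale_def by (rule convex_scaling)

lemma mscale_one [simp]: "mscale 1 K = K"
  by (simp add: mscale_def)

lemma mscale_mscale: "mscale s (mscale t K) = mscale (s * t) K"
  by (simp add: mscale_def image_image)

lemma mscale_msum: "mscale t (msum K L) = msum (mscale t K) (mscale t L)"
proof
  show "mscale t (msum K L) \<subseteq> msum (mscale t K) (mscale t L)"
    by (auto simp: mscale_def scaleR_add_right elim!: msumE intro!: msumI)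
  show "msum (mscale t K) (mscale t L) \<subseteq> mscale t (msum K L)"
    by (auto simp: mscale_def scaleR_add_right[symmetric] elim!: msumE intro!: imageI msumI)
qed

lemma area_mscale: "area (mscale t K) = t\<^sup>2 * area K"
  using measure_lebesgue_affine[of t 0 K] by (simp add: mscale_def)

text \<open>Convexity gives the inclusion from left to right: \<open>s x + t y\<close> is
  \<open>s + t\<close> times a convex combination of \<open>x\<close> and \<open>y\<close>. The
  other inclusion splits \<open>(s + t) x\<close> into \<open>s x + t x\<close>.\<close>

lemma msum_mscale_convex:
  assumes "convex K" "s \<ge> 0" "t \<ge> 0"
  shows "msum (mscale s K) (mscale t K) = mscale (s + t) K"
proof
  show "mscale (s + t) K \<subseteq> msum (mscale s K) (mscale t K)"
    by (auto simp: mscale_def msum_def scaleR_add_left)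
  show "msum (mscale s K) (mscale t K) \<subseteq> mscale (s + t) K"
  proof
    fix z assume "z \<in> msum (mscale s K) (mscale t K)"
    then obtain x y where xy: "x \<in> K" "y \<in> K" "z = s *\<^sub>R x + t *\<^sub>R y"
      by (auto simp: mscale_def msum_def)
    show "z \<in> mscale (s + t) K"
    proof (cases "s + t = 0")
      case True
      then have "s = 0" "t = 0" using assms by auto
      then show ?thesis using xy by (auto simp: mscale_def)
    next
      case False
      then have p: "s + t > 0" using assms by auto
      have "(s / (s + t)) *\<^sub>R x + (t / (s + t)) *\<^sub>R y \<in> K"
        using assms xy p by (intro convexD) (auto simp: add_divide_distrib[symmetric])
      moreover have "z = (s + t) *\<^sub>R ((s / (s + t)) *\<^sub>R x + (t / (s + t)) *\<^sub>R y)"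
        using p xy by (simp add: scaleR_add_right)
      ultimately show ?thesis unfolding mscale_def by blast
    qed
  qed
qed

lemma area_mono: "K \<subseteq> L \<Longrightarrow> compact K \<Longrightarrow> compact L \<Longrightarrow> area K \<le> area L"
  by (meson fmeasurableD lmeasurable_compact measure_mono_fmeasurable)

text \<open>If \<open>f p + l = f q + m\<close> with \<open>p\<close>, \<open>q\<close> on different sides of the hyperplane, the convex combination
  of the two representations that puts the first component on the hyperplane represents the same point.
  In particular \<open>f\<close> need not be injective, so degenerate triangles need no separate treatment.\<close>

lemma area_msum_cut:
  fixes f :: "'a::euclidean_space \<Rightarrow> real^2"
  assumes f: "linear f" and R: "compact R" "convex R" and L: "compact L" "convex L"
  shows "area (msum (f ` R) L) + area (msum (f ` (R \<inter> {r. a \<bullet> r = c})) L) =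
         area (msum (f ` (R \<inter> {r. a \<bullet> r \<le> c})) L) + area (msum (f ` (R \<inter> {r. a \<bullet> r \<ge> c})) L)"
proof -
  let ?A = "msum (f ` (R \<inter> {r. a \<bullet> r \<le> c})) L" and ?B = "msum (f ` (R \<inter> {r. a \<bullet> r \<ge> c})) L"
  have cf: "continuous_on X f" for X
    by (rule linear_continuous_on[OF f[unfolded linear_conv_bounded_linear]])
  have AB: "?A \<in> lmeasurable" "?B \<in> lmeasurable"
    by (intro lmeasurable_compact compact_msum L compact_continuous_image cf compact_Int_closed R
        closed_halfspace_le closed_halfspace_ge)+
  have un: "?A \<union> ?B = msum (f ` R) L"
    by (fastforce simp: msum_def)
  have "?A \<inter> ?B \<subseteq> msum (f ` (R \<inter> {r. a \<bullet> r = c})) L"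
  proof
    fix z assume z: "z \<in> ?A \<inter> ?B"
    then obtain p l where p: "p \<in> R" "a \<bullet> p \<le> c" "l \<in> L" "z = f p + l"
      by (auto simp: msum_def)
    from z obtain q m where q: "q \<in> R" "a \<bullet> q \<ge> c" "m \<in> L" "z = f q + m"
      by (auto simp: msum_def)
    \<comment> \<open>If the two values agree, both equal \<open>c\<close>, and \<open>s = 0\<close>
      serves.\<close>
    obtain s where s: "0 \<le> s" "s \<le> 1" "(1 - s) * (a \<bullet> p) + s * (a \<bullet> q) = c"
    proof (cases "a \<bullet> p = a \<bullet> q")
      case True
      then show ?thesis using that[of 0] p q by auto
    next
      case False
      then have lt: "a \<bullet> p < a \<bullet> q" using p q by auto
      show ?thesis
      proof (rule that[of "(c - a \<bullet> p) / (a \<bullet> q - a \<bullet> p)"])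
        show "(1 - (c - a \<bullet> p) / (a \<bullet> q - a \<bullet> p)) * (a \<bullet> p) + (c - a \<bullet> p) / (a \<bullet> q - a \<bullet> p) * (a \<bullet> q) = c"
          using lt by (simp add: divide_simps) (simp add: algebra_simps)
      qed (use lt p q in \<open>auto simp: divide_simps\<close>)
    qed
    define r where "r = (1 - s) *\<^sub>R p + s *\<^sub>R q"
    have "r \<in> R \<inter> {r. a \<bullet> r = c}"
      using s p q R(2) by (auto simp: r_def inner_add_right intro: convexD)
    moreover have "(1 - s) *\<^sub>R l + s *\<^sub>R m \<in> L"
      using s p q L(2) by (auto intro: convexD)
    moreover have "z = f r + ((1 - s) *\<^sub>R l + s *\<^sub>R m)"
    proof -
      have "z = (1 - s) *\<^sub>R z + s *\<^sub>R z" by (simp add: algebra_simps)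
      also have "\<dots> = (1 - s) *\<^sub>R (f p + l) + s *\<^sub>R (f q + m)" using p q by simp
      also have "\<dots> = f r + ((1 - s) *\<^sub>R l + s *\<^sub>R m)"
        by (simp add: r_def linear_add[OF f] linear_cmul[OF f] scaleR_add_right)
      finally show ?thesis .
    qed
    ultimately show "z \<in> msum (f ` (R \<inter> {r. a \<bullet> r = c})) L"
      by (auto simp: msum_def)
  qed
  moreover have "msum (f ` (R \<inter> {r. a \<bullet> r = c})) L \<subseteq> ?A \<inter> ?B"
    by (fastforce simp: msum_def)
  ultimately have "?A \<inter> ?B = msum (f ` (R \<inter> {r. a \<bullet> r = c})) L" by blast
  then show ?thesis using measure_Un3[OF AB] un by simp
qed

section \<open>Continuity of the area under outer approximation\<close>

text \<open>The parallel bodies decrease to \<open>M\<close> because \<open>M\<close> is closed, so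
  continuity of the measure from above applies.\<close>

lemma area_msum_cball_tendsto:
  assumes M: "compact M"
  shows "(\<lambda>n. area (msum M (cball 0 (1 / real (Suc n))))) \<longlonglongrightarrow> area M"
proof -
  let ?B = "\<lambda>n. msum M (cball 0 (1 / real (Suc n)))"
  have c: "compact (?B n)" for n
    by (intro compact_msum M compact_cball)
  have "(\<lambda>n. area (?B n)) \<longlonglongrightarrow> area (\<Inter>n. ?B n)"
  proof (rule Lim_measure_decseq)
    show "range ?B \<subseteq> sets lebesgue"
      using c lmeasurable_compact by blast
    show "decseq ?B"
      unfolding decseq_def
      by (intro allI impI msum_mono subset_cball) (auto simp: frac_le)
    show "emeasure lebesgue (?B i) \<noteq> \<infinity>" for i
      using fmeasurableD2[OF lmeasurable_compact[OF c]] by (simp add: top_ennreal_def)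
  qed
  moreover have "(\<Inter>n. ?B n) = M"
  proof
    show "M \<subseteq> (\<Inter>n. ?B n)"
    proof
      fix z assume "z \<in> M"
      then have "z + 0 \<in> ?B n" for n by (intro msumI) auto
      then show "z \<in> (\<Inter>n. ?B n)" by simp
    qed
    show "(\<Inter>n. ?B n) \<subseteq> M"
    proof
      fix z assume z: "z \<in> (\<Inter>n. ?B n)"
      have "\<exists>y\<in>M. dist y z < e" if e: "e > 0" for e
      proof -
        obtain n where n: "1 / real (Suc n) < e" using nat_approx_posE[OF e] by blast
        from z have "z \<in> ?B n" by auto
        then obtain x y where "x \<in> M" "norm y \<le> 1 / real (Suc n)" "z = x + y"
          by (auto elim!: msumE)
        then show ?thesis using n by (intro bexI[of _ x]) (auto simp: dist_norm)
      qed
      then have "z \<in> closure M" by (simp add: closure_approachable)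
      then show "z \<in> M" using M compact_imp_closed closure_closed by blast
    qed
  qed
  ultimately show ?thesis by simp
qed

text \<open>\<open>area (C n)\<close> is squeezed between \<open>area M\<close> and the area of a
  parallel body of \<open>M\<close>, and the latter can be brought below any bound above
  \<open>area M\<close>.\<close>

lemma area_tendsto_outer:
  assumes M: "compact M" and C: "\<And>n. compact (C n)" and sub: "\<And>n. M \<subseteq> C n"
    and close: "\<And>e. e > 0 \<Longrightarrow> eventually (\<lambda>n. C n \<subseteq> msum M (cball 0 e)) sequentially"
  shows "(\<lambda>n. area (C n)) \<longlonglongrightarrow> area M"
proof (rule order_tendstoI)
  fix a assume "a < area M"
  then show "eventually (\<lambda>n. a < area (C n)) sequentially"
    using area_mono[OF sub M C] by (intro always_eventually allI) (rule less_le_trans)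
next
  fix a assume "area M < a"
  then have "eventually (\<lambda>n. area (msum M (cball 0 (1 / real (Suc n)))) < a) sequentially"
    using area_msum_cball_tendsto[OF M] by (rule order_tendstoD(2)[rotated])
  then obtain k where k: "area (msum M (cball 0 (1 / real (Suc k)))) < a"
    by (auto simp: eventually_sequentially)
  have e: "1 / real (Suc k) > 0" by simp
  show "eventually (\<lambda>n. area (C n) < a) sequentially"
    using close[OF e]
  proof eventually_elim
    case (elim n)
    have "area (C n) \<le> area (msum M (cball 0 (1 / real (Suc k))))"
      by (rule area_mono[OF elim C]) (intro compact_msum M compact_cball)
    then show ?case using k by simp
  qed
qed

section \<open>The second difference of the area along a Minkowski sum\<close>

text \<open>Every triangle is a translate of some \<open>tri u v\<close>. Parallel \<open>u\<close>
  and \<open>v\<close> are allowed, so segments and points occur as degenerate cases.\<close>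

definition tri :: "real^2 \<Rightarrow> real^2 \<Rightarrow> (real^2) set" where
  "tri u v = convex hull {0, u, v}"

lemma convex_hull_3_image:
  "convex hull {a, b, c} = (\<lambda>x. a + x) ` tri (b - a) (c - a)"
  using convex_hull_translation[of a "{0, b - a, c - a}"] by (simp add: tri_def)

text \<open>This linear parametrization by the standard triangle lets all cuts be made along
  explicit lines of the parameter plane, also when the map is not injective.\<close>

lemma tri_eq:
  "tri u v = (\<lambda>r. fst r *\<^sub>R u + snd r *\<^sub>R v) `
    {r::real\<times>real. 0 \<le> fst r \<and> 0 \<le> snd r \<and> fst r + snd r \<le> 1}"
  unfolding tri_def convex_hull_3_alt by (force simp: image_iff)

lemma compact_tri: "compact (tri u v)" and convex_tri: "convex (tri u v)"
  by (simp_all add: tri_def finite_imp_compact_convex_hull)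

lemma mscale_tri: "mscale t (tri u v) = tri (t *\<^sub>R u) (t *\<^sub>R v)"
  using convex_hull_scaling[of t "{0, u, v}"] by (simp add: tri_def mscale_def)

lemma area_msum_segment_uminus:
  "area (msum (closed_segment 0 (- w)) L) = area (msum (closed_segment 0 w) L)"
proof -
  have "closed_segment 0 (- w) = (\<lambda>x. - w + x) ` closed_segment 0 w"
    using closed_segment_translation[of "- w" 0 w] by (simp add: closed_segment_commute)
  then show ?thesis by (simp only: msum_translation_left area_translation)
qed

text \<open>The point \<open>w\<close> cuts the doubled segment into two translates of the segment
  from 0 to \<open>w\<close>; the cut itself contributes \<open>area L\<close>.\<close>

lemma area_msum_segment_double:
  assumes L: "compact L" "convex L"
  shows "area (msum (closed_segment 0 (2 *\<^sub>R w)) L) + area L = 2 * area (msum (closed_segment 0 w) L)"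
proof -
  let ?f = "\<lambda>t::real. t *\<^sub>R w"
  have seg: "closed_segment 0 w = ?f ` {0..1}"
    by (force simp: closed_segment_def)
  have seg2: "closed_segment 0 (2 *\<^sub>R w) = ?f ` {0..2}"
  proof -
    have "closed_segment 0 (2 *\<^sub>R w) = (\<lambda>t. t *\<^sub>R (2 *\<^sub>R w)) ` {0..1}"
      by (force simp: closed_segment_def)
    also have "\<dots> = ?f ` ((\<lambda>t. 2 * t) ` {0..1})"
      by (simp add: image_image mult.commute)
    also have "(\<lambda>t::real. 2 * t) ` {0..1} = {0..2}"
      by simp
    finally show ?thesis .
  qed
  have lo: "{0..2} \<inter> {r::real. 1 \<bullet> r \<le> 1} = {0..1}" by auto
  have hi: "{0..2} \<inter> {r::real. 1 \<bullet> r \<ge> 1} = (\<lambda>x. 1 + x) ` {0..1}" by auto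
  have mid: "{0..2} \<inter> {r::real. 1 \<bullet> r = 1} = {1}" by auto
  have hi': "?f ` (\<lambda>x. 1 + x) ` {0..1} = (\<lambda>x. w + x) ` ?f ` {0..1}"
    unfolding image_image by (simp only: scaleR_add_left scaleR_one)
  have mid': "area (msum (?f ` {1}) L) = area L"
    using msum_translation_left[of w "{0}" L] by (simp add: msum_commute[of "{0}"])
  have "linear ?f" by (rule linear_scaleR_left)
  from area_msum_cut[OF this, of "{0..2}" L 1 1] L
  show ?thesis
    unfolding lo hi mid hi' mid' msum_translation_left area_translation seg[symmetric] seg2[symmetric]
    by simp
qed

text \<open>Three successive cuts along the midlines, made on the parameter triangle. The three
  segment terms are the images of the cuts up to translation.\<close>

lemma area_msum_tri_double:
  assumes L: "compact L" "convex L"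
  shows "area (msum (tri (2 *\<^sub>R u) (2 *\<^sub>R v)) L)
    + area (msum (closed_segment 0 u) L) + area (msum (closed_segment 0 v) L)
    + area (msum (closed_segment 0 (v - u)) L)
    = 3 * area (msum (tri u v) L) + area (msum (tri (- u) (- v)) L)"
proof -
  define f :: "real \<times> real \<Rightarrow> real^2" where "f = (\<lambda>r. fst r *\<^sub>R u + snd r *\<^sub>R v)"
  \<comment> \<open>\<open>R m\<close> is the standard triangle of side \<open>m\<close>,
    \<open>R1\<close> is \<open>R 2\<close> with its corner at \<open>(2, 0)\<close> cut off, and
    \<open>Q\<close> is the unit square that remains when the corner at \<open>(0, 2)\<close> is cut
    off too. The coordinate bounds present each region as a box cut by a half-plane, the form
    treated by \<open>cc\<close>.\<close>
  define R :: "real \<Rightarrow> (real \<times> real) set" where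
    "R = (\<lambda>m. {r. fst r \<le> m \<and> snd r \<le> m \<and> 0 \<le> fst r \<and> 0 \<le> snd r \<and> fst r + snd r \<le> m})"
  define R1 :: "(real \<times> real) set" where
    "R1 = {r. fst r \<le> 1 \<and> snd r \<le> 2 \<and> 0 \<le> fst r \<and> 0 \<le> snd r \<and> fst r + snd r \<le> 2}"
  define Q :: "(real \<times> real) set" where
    "Q = {r. fst r \<le> 1 \<and> snd r \<le> 1 \<and> 0 \<le> fst r \<and> 0 \<le> snd r \<and> fst r + snd r \<le> 2}"
  have lin: "linear f"
    unfolding f_def by (rule linearI) (auto simp: algebra_simps)
  have cc: "compact S \<and> convex S"
    if "S = {r. fst r \<le> a \<and> snd r \<le> b \<and> 0 \<le> fst r \<and> 0 \<le> snd r \<and> fst r + snd r \<le> m}"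
    for S :: "(real \<times> real) set" and a b m
  proof -
    have "S = ({0..a} \<times> {0..b}) \<inter> {r. (1,1) \<bullet> r \<le> m}"
      using that by (auto simp: inner_prod_def)
    then show ?thesis
      by (auto intro!: compact_Int_closed compact_Times convex_Int convex_Times closed_halfspace_le convex_halfspace_le)
  qed
  have ccs: "compact (R m)" "convex (R m)" "compact R1" "convex R1" "compact Q" "convex Q" for m
    using cc[OF R_def[THEN fun_cong]] cc[OF R1_def] cc[OF Q_def] by auto
  have T: "f ` R 1 = tri u v"
    unfolding tri_eq f_def R_def by (rule arg_cong[where f="\<lambda>X. _ ` X"]) auto
  have T2: "f ` R 2 = tri (2 *\<^sub>R u) (2 *\<^sub>R v)"
  proof -
    have "R 2 = (\<lambda>r. 2 *\<^sub>R r) ` R 1"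
    proof
      show "R 2 \<subseteq> (\<lambda>r. 2 *\<^sub>R r) ` R 1"
        by (rule subsetI, rule_tac x="(1/2) *\<^sub>R x" in image_eqI) (auto simp: R_def)
    qed (auto simp: R_def)
    then have "f ` R 2 = mscale 2 (f ` R 1)"
      by (simp add: mscale_def image_image linear_cmul[OF lin])
    then show ?thesis by (simp add: T mscale_tri)
  qed
  have N: "(\<lambda>r. - f r) ` R 1 = tri (- u) (- v)"
    unfolding tri_eq f_def R_def by (rule image_cong) auto
  have tr: "area (msum (f ` (\<lambda>r. p + r) ` S) L) = area (msum (f ` S) L)" for p S
  proof -
    have "f ` (\<lambda>r. p + r) ` S = (\<lambda>x. f p + x) ` f ` S"
      by (simp add: image_image linear_add[OF lin])
    then show ?thesis by (simp only: msum_translation_left area_translation)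
  qed
  have su: "f ` ({0..1} \<times> {0}) = closed_segment 0 u"
    by (force simp: f_def closed_segment_def)
  have sv: "f ` ({0} \<times> {0..1}) = closed_segment 0 v"
    by (force simp: f_def closed_segment_def)
  have A: "area (msum (f ` R 2) L) + area (msum (closed_segment 0 v) L) =
        area (msum (f ` R1) L) + area (msum (f ` R 1) L)"
  proof -
    have "R 2 \<inter> {r. (1,0) \<bullet> r \<le> 1} = R1" by (auto simp: R_def R1_def inner_prod_def)
    moreover have "R 2 \<inter> {r. (1,0) \<bullet> r \<ge> 1} = (\<lambda>r. (1,0) + r) ` R 1"
    proof
      show "R 2 \<inter> {r. (1,0) \<bullet> r \<ge> 1} \<subseteq> (\<lambda>r. (1,0) + r) ` R 1"
        by (rule subsetI, rule_tac x="x - (1,0)" in image_eqI) (auto simp: R_def inner_prod_def)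
    qed (auto simp: R_def inner_prod_def)
    moreover have "R 2 \<inter> {r. (1,0) \<bullet> r = 1} = (\<lambda>r. (1,0) + r) ` ({0} \<times> {0..1})"
    proof
      show "R 2 \<inter> {r. (1,0) \<bullet> r = 1} \<subseteq> (\<lambda>r. (1,0) + r) ` ({0} \<times> {0..1})"
        by (rule subsetI, rule_tac x="x - (1,0)" in image_eqI) (auto simp: R_def inner_prod_def)
    qed (auto simp: R_def inner_prod_def)
    ultimately show ?thesis
      using area_msum_cut[OF lin ccs(1,2)[of 2] L, of "(1,0)" 1] by (simp add: tr sv)
  qed
  have B: "area (msum (f ` R1) L) + area (msum (closed_segment 0 u) L) =
        area (msum (f ` Q) L) + area (msum (f ` R 1) L)"
  proof -
    have "R1 \<inter> {r. (0,1) \<bullet> r \<le> 1} = Q" by (auto simp: R1_def Q_def inner_prod_def)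
    moreover have "R1 \<inter> {r. (0,1) \<bullet> r \<ge> 1} = (\<lambda>r. (0,1) + r) ` R 1"
    proof
      show "R1 \<inter> {r. (0,1) \<bullet> r \<ge> 1} \<subseteq> (\<lambda>r. (0,1) + r) ` R 1"
        by (rule subsetI, rule_tac x="x - (0,1)" in image_eqI) (auto simp: R_def R1_def inner_prod_def)
    qed (auto simp: R_def R1_def inner_prod_def)
    moreover have "R1 \<inter> {r. (0,1) \<bullet> r = 1} = (\<lambda>r. (0,1) + r) ` ({0..1} \<times> {0})"
    proof
      show "R1 \<inter> {r. (0,1) \<bullet> r = 1} \<subseteq> (\<lambda>r. (0,1) + r) ` ({0..1} \<times> {0})"
        by (rule subsetI, rule_tac x="x - (0,1)" in image_eqI) (auto simp: R1_def inner_prod_def)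
    qed (auto simp: R1_def inner_prod_def)
    ultimately show ?thesis
      using area_msum_cut[OF lin ccs(3,4) L, of "(0,1)" 1] by (simp add: tr su)
  qed
  \<comment> \<open>The diagonal \<open>fst + snd = 1\<close> halves the square into
    \<open>R 1\<close> and the reflected copy \<open>(1,1) - R 1\<close>, the source of the triangle
    with \<open>- u\<close> and \<open>- v\<close>.\<close>
  have C: "area (msum (f ` Q) L) + area (msum (closed_segment 0 (v - u)) L) =
        area (msum (f ` R 1) L) + area (msum (tri (- u) (- v)) L)"
  proof -
    have "Q \<inter> {r. (1,1) \<bullet> r \<le> 1} = R 1" by (auto simp: R_def Q_def inner_prod_def)
    moreover have "area (msum (f ` (Q \<inter> {r. (1,1) \<bullet> r \<ge> 1})) L) = area (msum (tri (- u) (- v)) L)"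
    proof -
      have "Q \<inter> {r. (1,1) \<bullet> r \<ge> 1} = (\<lambda>r. (1,1) + r) ` (\<lambda>r. - r) ` R 1"
      proof
        show "Q \<inter> {r. (1,1) \<bullet> r \<ge> 1} \<subseteq> (\<lambda>r. (1,1) + r) ` (\<lambda>r. - r) ` R 1"
          unfolding image_image
          by (rule subsetI, rule_tac x="(1,1) - x" in image_eqI) (auto simp: R_def Q_def inner_prod_def)
      qed (auto simp: R_def Q_def inner_prod_def)
      then show ?thesis by (simp only: tr) (simp add: image_image linear_neg[OF lin] N)
    qed
    moreover have "area (msum (f ` (Q \<inter> {r. (1,1) \<bullet> r = 1})) L) = area (msum (closed_segment 0 (v - u)) L)"
    proof -
      have "Q \<inter> {r. (1,1) \<bullet> r = 1} = (\<lambda>r. (1,0) + r) ` (\<lambda>t. (-t, t)) ` {0..1}"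
      proof
        show "Q \<inter> {r. (1,1) \<bullet> r = 1} \<subseteq> (\<lambda>r. (1,0) + r) ` (\<lambda>t. (-t, t)) ` {0..1}"
          unfolding image_image
          by (rule subsetI, rule_tac x="snd x" in image_eqI) (auto simp: Q_def inner_prod_def prod_eq_iff)
      qed (auto simp: Q_def inner_prod_def)
      moreover have "f ` (\<lambda>t. (-t, t)) ` {0..1} = closed_segment 0 (v - u)"
        by (force simp: f_def closed_segment_def scaleR_diff_right)
      ultimately show ?thesis by (simp only: tr)
    qed
    ultimately show ?thesis
      using area_msum_cut[OF lin ccs(5,6) L, of "(1,1)" 1] by simp
  qed
  show ?thesis using A B C T T2 by simp
qed

section \<open>The second difference for triangles\<close>

text \<open>This is the second difference of \<open>t \<mapsto> area (tK + L)\<close> at 0, 1, 2,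
  less the value it has for a quadratic polynomial with leading coefficient
  \<open>area K\<close>.\<close>

definition second_diff :: "(real^2) set \<Rightarrow> (real^2) set \<Rightarrow> real" where
  "second_diff L K = area (msum (mscale 2 K) L) - 2 * area (msum K L) + area L - 2 * area K"

text \<open>The scaled copies of \<open>L\<close> shrink into any ball around 0, while
  \<open>0 \<in> L\<close> makes every sum contain \<open>K\<close>.\<close>

lemma area_msum_mscale_tendsto:
  assumes K: "compact K" and L: "compact L" "0 \<in> L"
  shows "(\<lambda>m. area (msum K (mscale (1 / 2 ^ m) L))) \<longlonglongrightarrow> area K"
proof (rule area_tendsto_outer[OF K])
  show "compact (msum K (mscale (1 / 2 ^ m) L))" for m
    by (intro compact_msum compact_mscale K L)
  show "K \<subseteq> msum K (mscale (1 / 2 ^ m) L)" for m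
  proof
    fix x assume "x \<in> K"
    then have "x + 0 \<in> msum K (mscale (1 / 2 ^ m) L)"
      using L(2) by (intro msumI) (auto simp: mscale_def image_iff)
    then show "x \<in> msum K (mscale (1 / 2 ^ m) L)" by simp
  qed
  fix e :: real assume e: "e > 0"
  obtain r where r: "\<And>x. x \<in> L \<Longrightarrow> norm x \<le> r"
    using compact_imp_bounded[OF L(1)] bounded_iff by blast
  have "(\<lambda>m. r * (1 / 2) ^ m) \<longlonglongrightarrow> r * 0"
    by (intro tendsto_intros LIMSEQ_power_zero) auto
  then have "eventually (\<lambda>m. r * (1 / 2) ^ m < e) sequentially"
    using e by (intro order_tendstoD(2)) auto
  then show "eventually (\<lambda>m. msum K (mscale (1 / 2 ^ m) L) \<subseteq> msum K (cball 0 e)) sequentially"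
  proof eventually_elim
    case (elim m)
    have "norm ((1 / 2 ^ m) *\<^sub>R x) \<le> e" if "x \<in> L" for x
      using mult_right_mono[OF r[OF that], of "(1/2)^m"] elim by (simp add: field_simps)
    then show ?case by (intro msum_mono) (auto simp: mscale_def)
  qed
qed

lemma second_diff_tri_zero_in:
  assumes L: "compact L" "convex L" "0 \<in> L"
  shows "second_diff L (tri u v) = 0"
proof -
  define F where "F = (\<lambda>u v. area (msum (tri u v) L))"
  define G where "G = (\<lambda>w. area (msum (closed_segment 0 w) L))"
  define c where "c = area L"
  \<comment> \<open>\<open>W\<close> is the deviation of the even part from its expected value. As
    \<open>T + (-T)\<close> is a translate of the sum of the segments from 0 to \<open>u\<close>,
    \<open>v\<close> and \<open>v - u\<close>, the linear term should be the sum of the three values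
    \<open>G - c\<close>.\<close>
  define W where "W = (\<lambda>u v. F u v + F (- u) (- v) - 2 * area (tri u v)
    - (G u + G v + G (v - u) - 3 * c) - 2 * c)"
  have G2: "G (2 *\<^sub>R w) = 2 * G w - c" for w
    using area_msum_segment_double[OF L(1,2), of w] by (simp add: G_def c_def)
  have Gm: "G (- w) = G w" for w
    by (simp add: G_def area_msum_segment_uminus)
  have F2: "F (2 *\<^sub>R u) (2 *\<^sub>R v) = 3 * F u v + F (- u) (- v) - (G u + G v + G (v - u))" for u v
    using area_msum_tri_double[OF L(1,2), of u v] by (simp add: F_def G_def)
  have F2m: "F (- (2 *\<^sub>R u)) (- (2 *\<^sub>R v)) = 3 * F (- u) (- v) + F u v - (G u + G v + G (v - u))" for u v
    using F2[of "- u" "- v"] Gm[of "v - u"] by (simp add: Gm)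
  have area_tri: "area (tri (t *\<^sub>R u) (t *\<^sub>R v)) = t\<^sup>2 * area (tri u v)" for t u v
    by (simp add: mscale_tri[symmetric] area_mscale)
  \<comment> \<open>Adding the dissections of the doubled triangle and of its reflection makes
    \<open>W\<close> scale by 4 under doubling.\<close>
  have W2: "W (2 *\<^sub>R u) (2 *\<^sub>R v) = 4 * W u v" for u v
    using G2[of "v - u"] by (simp add: W_def F2 F2m G2 area_tri scaleR_diff_right)
  have Wm: "W (2 ^ m *\<^sub>R u) (2 ^ m *\<^sub>R v) = 4 ^ m * W u v" for m u v
  proof (induction m)
    case (Suc m)
    then show ?case using W2[of "2 ^ m *\<^sub>R u" "2 ^ m *\<^sub>R v"] by simp
  qed simp
  have Gpow: "G (2 ^ m *\<^sub>R w) = 2 ^ m * (G w - c) + c" for m w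
  proof (induction m)
    case (Suc m)
    then show ?case using G2[of "2 ^ m *\<^sub>R w"] by (simp add: algebra_simps)
  qed simp
  have Fpow: "F (2 ^ m *\<^sub>R u) (2 ^ m *\<^sub>R v) = 4 ^ m * area (msum (tri u v) (mscale (1 / 2 ^ m) L))" for m u v
  proof -
    have "msum (tri (2 ^ m *\<^sub>R u) (2 ^ m *\<^sub>R v)) L = mscale (2 ^ m) (msum (tri u v) (mscale (1 / 2 ^ m) L))"
      by (simp add: mscale_msum mscale_tri mscale_mscale)
    then show ?thesis
      by (simp add: F_def area_mscale power2_eq_square power_mult_distrib[symmetric])
  qed
  \<comment> \<open>Dividing the identity at scale \<open>2^m\<close> by \<open>4^m\<close> turns
    the \<open>F\<close> terms into areas of a triangle plus a shrinking copy of \<open>L\<close>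
    and sends the linear and constant terms to 0. The limit is
    \<open>area T + area (-T) - 2 area T = 0\<close>.\<close>
  have W0: "W u v = 0" for u v
  proof -
    let ?A = "\<lambda>u v m. area (msum (tri u v) (mscale (1 / 2 ^ m) L))"
    let ?s = "G u + G v + G (v - u) - 3 * c"
    have "W u v = ?A u v m + ?A (- u) (- v) m - 2 * area (tri u v) - ?s * (1 / 2) ^ m - 2 * c * (1 / 4) ^ m" for m
    proof -
      have p: "(2::real) ^ m * 2 ^ m = 4 ^ m" by (simp add: power_mult_distrib[symmetric])
      have "4 ^ m * W u v = 4 ^ m * (?A u v m + ?A (- u) (- v) m - 2 * area (tri u v)) - 2 ^ m * ?s - 2 * c"
        using Wm[of m u v, symmetric] Fpow[of m u v] Fpow[of m "- u" "- v"] Gpow[of m u] Gpow[of m v] Gpow[of m "v - u"]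
        by (simp add: W_def area_tri algebra_simps power2_eq_square p)
      then have "W u v = (4 ^ m * (?A u v m + ?A (- u) (- v) m - 2 * area (tri u v)) - 2 ^ m * ?s - 2 * c) / 4 ^ m"
        by (simp add: field_simps)
      also have "\<dots> = ?A u v m + ?A (- u) (- v) m - 2 * area (tri u v) - ?s * (2 ^ m / 4 ^ m) - 2 * c / 4 ^ m"
        by (simp add: diff_divide_distrib)
      also have "(2::real) ^ m / 4 ^ m = (1 / 2) ^ m"
        by (simp add: power_divide[symmetric])
      finally show ?thesis by (simp add: power_divide)
    qed
    moreover have "(\<lambda>m. ?A u v m + ?A (- u) (- v) m - 2 * area (tri u v) - ?s * (1 / 2) ^ m - 2 * c * (1 / 4) ^ m)
      \<longlonglongrightarrow> area (tri u v) + area (tri (- u) (- v)) - 2 * area (tri u v) - ?s * 0 - 2 * c * 0"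
      by (intro tendsto_intros area_msum_mscale_tendsto compact_tri L LIMSEQ_power_zero) auto
    ultimately have "(\<lambda>m. W u v) \<longlonglongrightarrow> area (tri u v) + area (tri (- u) (- v)) - 2 * area (tri u v) - ?s * 0 - 2 * c * 0"
      by simp
    then have "W u v = area (tri u v) + area (tri (- u) (- v)) - 2 * area (tri u v)"
      using LIMSEQ_const_iff by fastforce
    then show ?thesis using area_tri[of "- 1" u v] by simp
  qed
  \<comment> \<open>By the dissection formula \<open>F2\<close>, this expression is exactly
    \<open>W u v\<close>.\<close>
  have "second_diff L (tri u v) = F (2 *\<^sub>R u) (2 *\<^sub>R v) - 2 * F u v + c - 2 * area (tri u v)"
    by (simp add: second_diff_def F_def c_def mscale_tri)
  then show ?thesis using W0[of u v] F2[of u v] by (simp add: W_def)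
qed

lemma msum_translation_right: "msum K ((\<lambda>x. a + x) ` L) = (\<lambda>x. a + x) ` msum K L"
  using msum_translation_left[of a L K] by (simp add: msum_commute)

lemma second_diff_translation_left: "second_diff ((\<lambda>x. a + x) ` L) K = second_diff L K"
  by (simp add: second_diff_def msum_translation_right)

lemma second_diff_translation_right: "second_diff L ((\<lambda>x. a + x) ` K) = second_diff L K"
proof -
  have "mscale 2 ((\<lambda>x. a + x) ` K) = (\<lambda>x. 2 *\<^sub>R a + x) ` mscale 2 K"
    by (simp add: mscale_def image_image scaleR_add_right)
  then show ?thesis by (simp add: second_diff_def msum_translation_left)
qed

text \<open>Translations of both bodies put 0 into \<open>L\<close> and a vertex of the triangle at
  the origin without changing the second difference.\<close>

lemma second_diff_convex_hull_3:
  assumes L: "compact L" "convex L" "L \<noteq> {}"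
  shows "second_diff L (convex hull {a, b, c}) = 0"
proof -
  obtain l where l: "l \<in> L" using L by blast
  have "second_diff ((\<lambda>x. - l + x) ` L) (tri (b - a) (c - a)) = 0"
    using L l by (intro second_diff_tri_zero_in compact_translation convex_translation) (auto simp: image_iff)
  then show ?thesis
    by (simp add: convex_hull_3_image second_diff_translation_right second_diff_translation_left
        del: add_uminus_conv_diff uminus_add_conv_diff)
qed

section \<open>From triangles to polygons\<close>

text \<open>Every term that depends on \<open>K\<close> satisfies the cut identity: the maps
  \<open>x\<close> and \<open>2 x\<close> give the terms with \<open>L\<close>, and summation with
  \<open>{0}\<close> gives \<open>area K\<close>.\<close>

lemma second_diff_cut:
  assumes K: "compact K" "convex K" and L: "compact L" "convex L"
  shows "second_diff L K + second_diff L (K \<inter> {x. a \<bullet> x = c}) =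
    second_diff L (K \<inter> {x. a \<bullet> x \<le> c}) + second_diff L (K \<inter> {x. a \<bullet> x \<ge> c})"
proof -
  have 1: "linear (\<lambda>x::real^2. x)" and 2: "linear (\<lambda>x::real^2. 2 *\<^sub>R x)"
    by (auto intro!: linearI simp: algebra_simps)
  show ?thesis
    using area_msum_cut[OF 1 K L, of a c] area_msum_cut[OF 2 K L, of a c]
      area_msum_cut[OF 1 K compact_sing convex_singleton, of 0 a c]
    by (simp add: second_diff_def mscale_def)
qed

text \<open>A point of the half-space lies on a segment from some \<open>p\<close> in the hull of
  the retained points to some \<open>q\<close> in the hull of the discarded ones. The segment meets
  the hyperplane at a point \<open>y\<close>, which the assumption puts into the smaller hull, and
  the given point lies between \<open>p\<close> and \<open>y\<close>.\<close>

lemma convex_hull_Int_halfspace: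
  fixes S :: "'a::euclidean_space set"
  assumes "convex hull S \<inter> {x. a \<bullet> x = c} \<subseteq> convex hull (S \<inter> {x. a \<bullet> x \<le> c})"
  shows "convex hull S \<inter> {x. a \<bullet> x \<le> c} = convex hull (S \<inter> {x. a \<bullet> x \<le> c})"
proof
  let ?S1 = "S \<inter> {x. a \<bullet> x \<le> c}" and ?S2 = "S \<inter> {x. a \<bullet> x > c}"
  have h1: "convex hull ?S1 \<subseteq> {x. a \<bullet> x \<le> c}"
    by (intro hull_minimal) (auto simp: convex_halfspace_le)
  have h2: "convex hull ?S2 \<subseteq> {x. a \<bullet> x > c}"
    by (intro hull_minimal) (auto simp: convex_halfspace_gt)
  show "convex hull ?S1 \<subseteq> convex hull S \<inter> {x. a \<bullet> x \<le> c}"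
    using h1 hull_mono[of ?S1 S] by blast
  show "convex hull S \<inter> {x. a \<bullet> x \<le> c} \<subseteq> convex hull ?S1"
  proof
    fix x assume x: "x \<in> convex hull S \<inter> {x. a \<bullet> x \<le> c}"
    have S: "S = ?S1 \<union> ?S2" by auto
    show "x \<in> convex hull ?S1"
    proof (cases "?S1 = {} \<or> ?S2 = {}")
      case True
      then show ?thesis
      proof
        assume "?S1 = {}"
        then have "?S2 = S" by auto
        then show ?thesis using h2 x by auto
      next
        assume "?S2 = {}"
        then have "?S1 = S" by auto
        then show ?thesis using x by simp
      qed
    next
      case False
      have "x \<in> convex hull (?S1 \<union> ?S2)" using x S by simp
      then obtain p q where p: "p \<in> convex hull ?S1" and q: "q \<in> convex hull ?S2"
        and xpq: "x \<in> closed_segment p q"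
      proof -
        have "x \<in> convex hull (convex hull ?S1 \<union> convex hull ?S2)"
          using \<open>x \<in> convex hull (?S1 \<union> ?S2)\<close> hull_mono[of "?S1 \<union> ?S2" "convex hull ?S1 \<union> convex hull ?S2" convex]
            hull_subset[of ?S1 convex] hull_subset[of ?S2 convex] by blast
        then obtain u v p q where "u \<ge> 0" "v \<ge> 0" "u + v = 1" "p \<in> convex hull ?S1" "q \<in> convex hull ?S2"
          "x = u *\<^sub>R p + v *\<^sub>R q"
          using False by (subst (asm) convex_hull_union_two) auto
        moreover from this have "u = 1 - v" by simp
        ultimately show ?thesis
          by (intro that[of p q]) (auto simp: closed_segment_def)
      qed
      obtain s where s: "0 \<le> s" "s \<le> 1" "x = (1 - s) *\<^sub>R p + s *\<^sub>R q"
        using xpq by (auto simp: closed_segment_def)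
      have ap: "a \<bullet> p \<le> c" and aq: "a \<bullet> q > c" using p q h1 h2 by auto
      define t where "t = (c - a \<bullet> p) / (a \<bullet> q - a \<bullet> p)"
      define y where "y = (1 - t) *\<^sub>R p + t *\<^sub>R q"
      have t: "0 \<le> t" "t \<le> 1" using ap aq by (auto simp: t_def divide_simps)
      have tc: "t * (a \<bullet> q - a \<bullet> p) = c - a \<bullet> p" using ap aq by (simp add: t_def)
      have ay: "a \<bullet> y = c" using tc by (simp add: y_def inner_add_right algebra_simps)
      have pS: "p \<in> convex hull S" and qS: "q \<in> convex hull S"
        using p q hull_mono[of ?S1 S] hull_mono[of ?S2 S] by auto
      have "y \<in> convex hull S"
        unfolding y_def using t pS qS by (intro convexD) auto
      then have y1: "y \<in> convex hull ?S1" using assms ay by blast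
      have "a \<bullet> x \<le> c" using x by simp
      then have "s * (a \<bullet> q - a \<bullet> p) \<le> t * (a \<bullet> q - a \<bullet> p)"
        unfolding tc using s(3) by (simp add: inner_add_right algebra_simps)
      then have st: "s \<le> t" using ap aq by simp
      show ?thesis
      proof (cases "t = 0")
        case True
        then show ?thesis using st s p by auto
      next
        case False
        then have t0: "t > 0" using t by simp
        have "x = (1 - s / t) *\<^sub>R p + (s / t) *\<^sub>R y"
          using t0 unfolding s(3) y_def by (simp add: algebra_simps)
        moreover have "(1 - s / t) *\<^sub>R p + (s / t) *\<^sub>R y \<in> convex hull ?S1"
          using st s t0 p y1 by (intro convexD) auto
        ultimately show ?thesis by simp
      qed
    qed
  qed
qed

text \<open>\<open>n\<close> is \<open>b - a\<close> turned by a right angle, so the hypothesis on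
  \<open>x\<close> says that the cross product of \<open>b - a\<close> and \<open>x - a\<close>
  vanishes. The witness \<open>t\<close> is the coefficient of the orthogonal projection of
  \<open>x - a\<close> to \<open>b - a\<close>.\<close>

lemma line_through_2:
  fixes a b x :: "real^2"
  assumes "a \<noteq> b" and n: "n = (\<chi> i. if i = 1 then - (b - a) $ 2 else (b - a) $ 1)"
    and x: "n \<bullet> x = n \<bullet> a"
  obtains t where "x = a + t *\<^sub>R (b - a)"
proof -
  let ?d = "b - a" and ?y = "x - a"
  have cross: "?d $ 1 * ?y $ 2 = ?d $ 2 * ?y $ 1"
    using x unfolding n by (simp add: inner_vec_def UNIV_2 algebra_simps)
  have "?d \<bullet> ?d \<noteq> 0" using assms by simp
  moreover have "?d \<bullet> ?d = (?d $ 1)\<^sup>2 + (?d $ 2)\<^sup>2"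
    by (simp add: inner_vec_def UNIV_2 power2_eq_square)
  ultimately have nz: "(?d $ 1)\<^sup>2 + (?d $ 2)\<^sup>2 \<noteq> 0" by simp
  define t where "t = (?d $ 1 * ?y $ 1 + ?d $ 2 * ?y $ 2) / ((?d $ 1)\<^sup>2 + (?d $ 2)\<^sup>2)"
  have tt: "t * ((?d $ 1)\<^sup>2 + (?d $ 2)\<^sup>2) = ?d $ 1 * ?y $ 1 + ?d $ 2 * ?y $ 2"
    using nz by (simp add: t_def)
  have "((?d $ 1)\<^sup>2 + (?d $ 2)\<^sup>2) * (t * ?d $ 1) = ((?d $ 1)\<^sup>2 + (?d $ 2)\<^sup>2) * ?y $ 1"
    using tt cross by algebra
  moreover have "((?d $ 1)\<^sup>2 + (?d $ 2)\<^sup>2) * (t * ?d $ 2) = ((?d $ 1)\<^sup>2 + (?d $ 2)\<^sup>2) * ?y $ 2"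
    using tt cross by algebra
  ultimately have "t * ?d $ 1 = ?y $ 1" "t * ?d $ 2 = ?y $ 2"
    using nz by auto
  then have "x = a + t *\<^sub>R ?d"
    by (simp add: vec_eq_iff forall_2)
  then show ?thesis by (rule that)
qed

text \<open>Induction on the number of spanning points. Points in the hull of the others are
  dropped; at most three points span a possibly degenerate triangle; otherwise a diagonal cuts the
  polygon into two hulls of fewer points.\<close>

lemma second_diff_polygon:
  assumes L: "compact L" "convex L" "L \<noteq> {}" and "finite S" "S \<noteq> {}"
  shows "second_diff L (convex hull S) = 0"
  using assms(4,5)
proof (induction "card S" arbitrary: S rule: less_induct)
  case less
  note IH = less.hyps and fin = less.prems(1) and ne = less.prems(2)
  show ?case
  proof (cases "\<exists>p\<in>S. p \<in> convex hull (S - {p})")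
    case True
    then obtain p where p: "p \<in> S" "p \<in> convex hull (S - {p})" by blast
    then have "convex hull S = convex hull (S - {p})"
      by (metis hull_redundant insert_Diff)
    moreover have "S - {p} \<noteq> {}" using p(2) by (metis convex_hull_empty empty_iff)
    moreover have "card (S - {p}) < card S" using p fin by (meson card_Diff1_less)
    ultimately show ?thesis using IH[of "S - {p}"] fin by simp
  next
    case False
    then have indep: "p \<notin> convex hull (S - {p})" if "p \<in> S" for p using that by blast
    have ext: "p extreme_point_of (convex hull S)" if "p \<in> S" for p
      using extreme_point_of_convex_hull_convex_independent[of S p] fin indep that
      by (simp add: finite_imp_compact)
    show ?thesis
    proof (cases "card S \<le> 3")
      case True
      have "card S \<noteq> 0" using fin ne by simp
      then consider "card S = 1" | "card S = 2" | "card S = 3" using True by linarith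
      then obtain a b c where "S = {a, b, c}"
      proof cases
        case 1 then show ?thesis using that by (metis card_1_singletonE insert_absorb2)
      next
        case 2 then show ?thesis using that by (metis card_2_iff insert_absorb2)
      next
        case 3 then show ?thesis using that by (metis card_3_iff)
      qed
      then show ?thesis using second_diff_convex_hull_3[OF L] by simp
    next
      case False
      then obtain C where C: "C \<subseteq> S" "card C = 4" "finite C"
        using obtain_subset_with_card_n[of 4 S] by auto
      \<comment> \<open>Four points in the plane are affinely dependent, and Radon's theorem splits
        them into two classes with intersecting hulls. As no point lies in the hull of the others,
        each class has two points, and the classes span crossing diagonals.\<close>
      then have "affine_dependent C"
        by (intro affine_dependent_biggerset) auto
      then obtain M P z where MP: "M \<inter> P = {}" "M \<union> P = C" "z \<in> convex hull M" "z \<in> convex hull P"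
        using Radon_partition[OF C(3)] by blast
      have card_ge: "card X \<ge> 2" if X: "X \<inter> Y = {}" "X \<union> Y = C" "z \<in> convex hull X" "z \<in> convex hull Y" for X Y
      proof (rule ccontr)
        assume "\<not> card X \<ge> 2"
        moreover have "finite X" "X \<noteq> {}" using X C by (auto intro: finite_subset)
        then have "card X \<noteq> 0" by simp
        ultimately obtain p where p: "X = {p}"
          using card_1_singletonE[of X] by (metis One_nat_def less_2_cases_iff linorder_not_le)
        then have "p \<in> convex hull Y" using X by auto
        moreover have "Y \<subseteq> S - {p}" using X C p by auto
        ultimately show False using indep[of p] hull_mono[of Y "S - {p}" convex] p X C by auto
      qed
      have "card M + card P = 4"
        using MP C by (metis card_Un_disjoint finite_Un)
      moreover have "card M \<ge> 2" "card P \<ge> 2" using card_ge[of M P] card_ge[of P M] MP by auto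
      ultimately have "card M = 2" "card P = 2" by auto
      then obtain a b c d where ab: "M = {a, b}" "a \<noteq> b" and cd: "P = {c, d}" "c \<noteq> d"
        by (meson card_2_iff)
      have inS: "a \<in> S" "b \<in> S" "c \<in> S" "d \<in> S" and diff: "c \<noteq> a" "c \<noteq> b" "d \<noteq> a" "d \<noteq> b"
        using MP C ab cd by auto
      define n :: "real^2" where "n = (\<chi> i. if i = 1 then - (b - a) $ 2 else (b - a) $ 1)"
      define k where "k = n \<bullet> a"
      have nb: "n \<bullet> b = k" by (simp add: k_def n_def inner_vec_def UNIV_2 algebra_simps)
      \<comment> \<open>A point of the hull on this line beyond \<open>a\<close> or \<open>b\<close>
        would put that vertex inside a segment of the hull, contrary to extremality.\<close>
      have diag: "convex hull S \<inter> {x. n \<bullet> x = k} = convex hull {a, b}"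
      proof
        show "convex hull {a, b} \<subseteq> convex hull S \<inter> {x. n \<bullet> x = k}"
          using hull_mono[of "{a, b}" S convex] inS nb k_def
            hull_minimal[of "{a, b}" "{x. n \<bullet> x = k}" convex] convex_hyperplane[of n k] by auto
        show "convex hull S \<inter> {x. n \<bullet> x = k} \<subseteq> convex hull {a, b}"
        proof
          fix x assume x: "x \<in> convex hull S \<inter> {x. n \<bullet> x = k}"
          obtain t where t: "x = a + t *\<^sub>R (b - a)"
            using line_through_2[OF ab(2) n_def, of x] x k_def by auto
          have aS: "a \<in> convex hull S" "b \<in> convex hull S" using inS hull_inc by metis+
          have "t \<le> 1"
          proof (rule ccontr)
            assume "\<not> t \<le> 1"
            then have t1: "t > 1" by simp
            have "b \<in> open_segment a x"
              unfolding in_segment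
            proof (intro conjI exI[of _ "1 / t"])
              show "a \<noteq> x" using t t1 ab(2) by simp
              have "b = (1 - 1 / t) *\<^sub>R a + (1 / t) *\<^sub>R (a + t *\<^sub>R (b - a))"
                using t1 by (simp add: scaleR_add_right scaleR_diff_left)
              then show "b = (1 - 1 / t) *\<^sub>R a + (1 / t) *\<^sub>R x" unfolding t .
            qed (use t1 in auto)
            then show False using ext[OF inS(2)] aS x by (auto simp: extreme_point_of_def)
          qed
          moreover have "t \<ge> 0"
          proof (rule ccontr)
            assume "\<not> t \<ge> 0"
            then have t1: "t < 0" by simp
            have "a \<in> open_segment x b"
              unfolding in_segment
            proof (intro conjI exI[of _ "- t / (1 - t)"])
              show "x \<noteq> b" using t t1 ab(2) by (auto simp: algebra_simps)
              have q: "1 - (- t / (1 - t)) = 1 / (1 - t)" using t1 by (simp add: field_simps)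
              have "(1 - t) *\<^sub>R a = x + (- t) *\<^sub>R b" by (simp add: t algebra_simps)
              then have "(1 / (1 - t)) *\<^sub>R ((1 - t) *\<^sub>R a) = (1 / (1 - t)) *\<^sub>R (x + (- t) *\<^sub>R b)" by simp
              then show "a = (1 - (- t / (1 - t))) *\<^sub>R x + (- t / (1 - t)) *\<^sub>R b"
                unfolding q using t1 by (simp add: scaleR_diff_right)
            qed (use t1 in \<open>auto simp: field_simps\<close>)
            then show False using ext[OF inS(1)] aS x by (auto simp: extreme_point_of_def)
          qed
          ultimately show "x \<in> convex hull {a, b}"
            unfolding segment_convex_hull[symmetric] in_segment using t
            by (auto intro!: exI[of _ t] simp: algebra_simps)
        qed
      qed
      have off: "n \<bullet> p \<noteq> k" if "p \<in> S" "p \<noteq> a" "p \<noteq> b" for p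
      proof
        assume "n \<bullet> p = k"
        then have "p \<in> convex hull {a, b}" using diag that hull_inc[of p S convex] by blast
        then show False using indep[OF that(1)] hull_mono[of "{a, b}" "S - {p}" convex] that inS by auto
      qed
      obtain s where s: "0 \<le> s" "s \<le> 1" "z = (1 - s) *\<^sub>R c + s *\<^sub>R d"
        using MP(4) cd by (auto simp: segment_convex_hull[symmetric] closed_segment_def)
      have "n \<bullet> z = k" using MP(3) ab diag by auto
      then have zk: "(1 - s) * (n \<bullet> c) + s * (n \<bullet> d) = k" using s by (simp add: inner_add_right)
      have nc: "n \<bullet> c \<noteq> k" "n \<bullet> d \<noteq> k" using off inS diff by auto
      \<comment> \<open>The Radon point \<open>z\<close> lies on the cutting line and between
        \<open>c\<close> and \<open>d\<close>, neither of which is on the line. Hence they lie on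
        opposite sides, and each closed half-plane misses a point of \<open>S\<close>.\<close>
      have opp: "\<exists>p\<in>S. n \<bullet> p < k" "\<exists>p\<in>S. n \<bullet> p > k"
      proof -
        have "\<not> (n \<bullet> c < k \<and> n \<bullet> d < k)"
          using zk s convex_bound_lt[of "n \<bullet> c" k "n \<bullet> d" "1 - s" s] by auto
        moreover have "\<not> (n \<bullet> c > k \<and> n \<bullet> d > k)"
          using zk s convex_bound_lt[of "- (n \<bullet> c)" "- k" "- (n \<bullet> d)" "1 - s" s] by auto
        ultimately show "\<exists>p\<in>S. n \<bullet> p < k" "\<exists>p\<in>S. n \<bullet> p > k"
          using nc inS(3,4) by (metis linorder_less_linear)+
      qed
      have lo: "convex hull S \<inter> {x. n \<bullet> x \<le> k} = convex hull (S \<inter> {x. n \<bullet> x \<le> k})"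
        proof (rule convex_hull_Int_halfspace)
        show "convex hull S \<inter> {x. n \<bullet> x = k} \<subseteq> convex hull (S \<inter> {x. n \<bullet> x \<le> k})"
          unfolding diag using inS nb k_def by (intro hull_mono) auto
      qed
      have "convex hull S \<inter> {x. (- n) \<bullet> x \<le> - k} = convex hull (S \<inter> {x. (- n) \<bullet> x \<le> - k})"
      proof (rule convex_hull_Int_halfspace)
        have "convex hull {a, b} \<subseteq> convex hull (S \<inter> {x. - n \<bullet> x \<le> - k})"
          using inS nb k_def by (intro hull_mono) auto
        then show "convex hull S \<inter> {x. - n \<bullet> x = - k} \<subseteq> convex hull (S \<inter> {x. - n \<bullet> x \<le> - k})"
          using diag by simp
      qed
      then have hi: "convex hull S \<inter> {x. n \<bullet> x \<ge> k} = convex hull (S \<inter> {x. n \<bullet> x \<ge> k})" by simp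
      have "second_diff L (convex hull (S \<inter> {x. n \<bullet> x \<le> k})) = 0"
      proof (rule IH)
        show "card (S \<inter> {x. n \<bullet> x \<le> k}) < card S" using opp(2) fin by (intro psubset_card_mono) force+
      qed (use fin inS k_def in auto)
      moreover have "second_diff L (convex hull (S \<inter> {x. n \<bullet> x \<ge> k})) = 0"
      proof (rule IH)
        show "card (S \<inter> {x. n \<bullet> x \<ge> k}) < card S" using opp(1) fin by (intro psubset_card_mono) force+
      qed (use fin inS k_def in auto)
      \<comment> \<open>The diagonal counts as a triangle with a repeated vertex.\<close>
      moreover have "second_diff L (convex hull {a, b}) = 0"
        using second_diff_convex_hull_3[OF L, of a b b] by simp
      moreover have "compact (convex hull S)" using fin by (rule finite_imp_compact_convex_hull)
      ultimately show ?thesis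
        using second_diff_cut[OF _ convex_convex_hull L(1,2), of S n k] by (simp add: diag lo hi)
    qed
  qed
qed

section \<open>From polygons to convex bodies\<close>

text \<open>Finitely many small boxes around points of \<open>K\<close> cover it. The hull of their
  finite spanning sets contains \<open>K\<close> and stays inside the parallel body, which is
  convex.\<close>

lemma outer_polygon:
  fixes K :: "(real^2) set"
  assumes K: "compact K" "convex K" "K \<noteq> {}" and e: "e > 0"
  obtains F where "finite F" "F \<noteq> {}" "K \<subseteq> convex hull F" "convex hull F \<subseteq> msum K (cball 0 e)"
proof -
  have "\<exists>a b. cbox a b \<subseteq> ball x e \<and> x \<in> box a b" for x :: "real^2"
    using open_contains_cbox[of "ball x e" x] e by (metis centre_in_ball open_ball)
  then obtain a b :: "real^2 \<Rightarrow> real^2" where ab: "\<And>x. cbox (a x) (b x) \<subseteq> ball x e" "\<And>x. x \<in> box (a x) (b x)" by metis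
  obtain D where D: "D \<subseteq> K" "finite D" "K \<subseteq> (\<Union>x\<in>D. box (a x) (b x))"
  proof (rule compactE_image[OF K(1), of K "\<lambda>x. box (a x) (b x)"])
    show "K \<subseteq> (\<Union>x\<in>K. box (a x) (b x))" using ab(2) by blast
  qed (auto simp: open_box)
  obtain V :: "real^2 \<Rightarrow> (real^2) set" where V: "\<And>x. finite (V x)" "\<And>x. cbox (a x) (b x) = convex hull (V x)"
  proof -
    have "\<exists>S. finite S \<and> cbox (a x) (b x) = convex hull S" for x
      by (meson closed_interval_as_convex_hull)
    then show ?thesis using that by metis
  qed
  define F where "F = (\<Union>x\<in>D. V x)"
  have sub: "cbox (a x) (b x) \<subseteq> convex hull F" if "x \<in> D" for x
    unfolding V(2) F_def using that by (intro hull_mono) auto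
  have KF: "K \<subseteq> convex hull F"
    using D(3) sub box_subset_cbox by blast
  show ?thesis
  proof (rule that)
    show "finite F" using D V by (auto simp: F_def)
    show "F \<noteq> {}" using KF K(3) by auto
    show "convex hull F \<subseteq> msum K (cball 0 e)"
    proof (rule hull_minimal)
      show "convex (msum K (cball 0 e))" by (intro convex_msum K convex_cball)
      show "F \<subseteq> msum K (cball 0 e)"
      proof
        fix v assume "v \<in> F"
        then obtain x where x: "x \<in> D" "v \<in> V x" by (auto simp: F_def)
        then have "v \<in> ball x e" using ab(1)[of x] V(2)[of x] hull_inc[of v "V x" convex] by auto
        then have "x + (v - x) \<in> msum K (cball 0 e)"
          using x D by (intro msumI) (auto simp: dist_norm norm_minus_commute)
        then show "v \<in> msum K (cball 0 e)" by simp
      qed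
    qed
  qed (rule KF)
qed

lemma second_diff_eq_0:
  assumes K: "compact K" "convex K" "K \<noteq> {}" and L: "compact L" "convex L" "L \<noteq> {}"
  shows "second_diff L K = 0"
proof -
  have "\<exists>F. finite F \<and> F \<noteq> {} \<and> K \<subseteq> convex hull F \<and> convex hull F \<subseteq> msum K (cball 0 (1 / real (Suc n)))" for n
    using outer_polygon[OF K, of "1 / real (Suc n)"] by (metis of_nat_0_less_iff zero_less_Suc zero_less_divide_1_iff)
  then obtain F where F: "\<And>n. finite (F n)" "\<And>n. F n \<noteq> {}" "\<And>n. K \<subseteq> convex hull F n"
    "\<And>n. convex hull F n \<subseteq> msum K (cball 0 (1 / real (Suc n)))" by metis
  have lim: "(\<lambda>n. area (msum (convex hull F n) M)) \<longlonglongrightarrow> area (msum K M)" if M: "compact M" for M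
  proof (rule area_tendsto_outer)
    show "compact (msum K M)" by (intro compact_msum K M)
    show "compact (msum (convex hull F n) M)" for n
      by (intro compact_msum M finite_imp_compact_convex_hull F)
    show "msum K M \<subseteq> msum (convex hull F n) M" for n
      by (intro msum_mono F order_refl)
    fix e :: real assume "e > 0"
    then have "eventually (\<lambda>n. 1 / real (Suc n) < e) sequentially"
      using order_tendstoD(2)[OF LIMSEQ_inverse_real_of_nat, of e] by (simp add: inverse_eq_divide)
    then show "eventually (\<lambda>n. msum (convex hull F n) M \<subseteq> msum (msum K M) (cball 0 e)) sequentially"
    proof eventually_elim
      case (elim n)
      have "msum (convex hull F n) M \<subseteq> msum (msum K (cball 0 (1 / real (Suc n)))) M"
        by (intro msum_mono F order_refl)
      also have "\<dots> = msum (msum K M) (cball 0 (1 / real (Suc n)))"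
        by (simp add: msum_assoc msum_commute[of M])
      also have "\<dots> \<subseteq> msum (msum K M) (cball 0 e)"
        using elim by (intro msum_mono order_refl subset_cball) simp
      finally show ?case .
    qed
  qed
  \<comment> \<open>After rescaling by 2, every term with \<open>X\<close> is the area of
    \<open>X\<close> plus a fixed compact set, so \<open>lim\<close> covers them all; the set
    \<open>{0}\<close> accounts for \<open>area X\<close>.\<close>
  have sd: "second_diff L X = 4 * area (msum X (mscale (1 / 2) L)) - 2 * area (msum X L)
    + area L - 2 * area (msum X {0})" for X
  proof -
    have "msum (mscale 2 X) L = mscale 2 (msum X (mscale (1 / 2) L))"
      by (simp add: mscale_msum mscale_mscale)
    then show ?thesis by (simp add: second_diff_def area_mscale)
  qed
  have "(\<lambda>n. second_diff L (convex hull F n)) \<longlonglongrightarrow> second_diff L K"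
    unfolding sd by (intro tendsto_intros lim compact_mscale L compact_sing)
  then have "(\<lambda>n. 0) \<longlonglongrightarrow> second_diff L K"
    using second_diff_polygon[OF L F(1,2)] by simp
  then show ?thesis using LIMSEQ_const_iff by metis
qed

section \<open>Homogeneity of the mixed area\<close>

text \<open>Translate the bodies so that they touch a common line at 0 from opposite sides. Each
  then lies in the sum because the other contains 0, and their overlap lies in the line, a null
  set.\<close>

lemma area_msum_ge:
  assumes K: "compact K" "K \<noteq> {}" and L: "compact L" "L \<noteq> {}"
  shows "area K + area L \<le> area (msum K L)"
proof -
  let ?e = "axis 1 1 :: real^2"
  have cont: "continuous_on X (\<lambda>x. ?e \<bullet> x)" for X by (intro continuous_intros)
  obtain k where k: "k \<in> K" "\<And>x. x \<in> K \<Longrightarrow> ?e \<bullet> x \<le> ?e \<bullet> k"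
    using continuous_attains_sup[OF K cont] by blast
  obtain l where l: "l \<in> L" "\<And>x. x \<in> L \<Longrightarrow> ?e \<bullet> l \<le> ?e \<bullet> x"
    using continuous_attains_inf[OF L cont] by blast
  define K' where "K' = (\<lambda>x. - k + x) ` K"
  define L' where "L' = (\<lambda>x. - l + x) ` L"
  have c: "compact K'" "compact L'"
    unfolding K'_def L'_def by (intro compact_translation K L)+
  have zero: "0 \<in> K'" "0 \<in> L'" using k l by (auto simp: K'_def L'_def image_iff)
  have "K' \<inter> L' \<subseteq> {x. ?e \<bullet> x = 0}"
  proof
    fix x assume "x \<in> K' \<inter> L'"
    then obtain p q where "p \<in> K" "x = - k + p" "q \<in> L" "x = - l + q" by (auto simp: K'_def L'_def)
    then have "x + k \<in> K" "x + l \<in> L" by (metis add.commute add_minus_cancel)+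
    then show "x \<in> {x. ?e \<bullet> x = 0}"
      using k(2)[of "x + k"] l(2)[of "x + l"] by (simp add: inner_add_right)
  qed
  moreover have "negligible {x. ?e \<bullet> x = 0}"
    by (rule negligible_hyperplane) (simp add: axis_eq_0_iff)
  ultimately have "area (K' \<inter> L') = 0"
    by (meson negligible_imp_measure0 negligible_subset)
  then have "area K' + area L' = area (K' \<union> L')"
    using measure_Un3[OF lmeasurable_compact[OF c(1)] lmeasurable_compact[OF c(2)]] by simp
  also have "\<dots> \<le> area (msum K' L')"
  proof (rule area_mono)
    show "K' \<union> L' \<subseteq> msum K' L'"
      using zero msumI[of _ K' 0 L'] msumI[of 0 K' _ L'] by auto
  qed (use c in \<open>auto intro: compact_msum\<close>)
  finally show ?thesis
    unfolding K'_def L'_def msum_translation_left msum_translation_right area_translation .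
qed

lemma mixed_vol_nonneg: "K \<in> K2 \<Longrightarrow> L \<in> K2 \<Longrightarrow> mixed_vol K L \<ge> 0"
  using area_msum_ge[of K L] by (auto simp: mixed_vol_def K2_def)

text \<open>The difference \<open>h\<close> from the linear function is additive with
  \<open>h 1 = 0\<close>, hence 1-periodic, and nonnegativity of \<open>d\<close> bounds it by
  \<open>d 1\<close> on the unit interval. Multiples of a nonzero value would exceed this
  bound.\<close>

lemma additive_nonneg_imp_linear:
  fixes d :: "real \<Rightarrow> real"
  assumes add: "\<And>x y. x \<ge> 0 \<Longrightarrow> y \<ge> 0 \<Longrightarrow> d (x + y) = d x + d y"
    and pos: "\<And>x. x \<ge> 0 \<Longrightarrow> d x \<ge> 0" and x: "x \<ge> 0"
  shows "d x = x * d 1"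
proof -
  define h where "h = (\<lambda>x. d x - x * d 1)"
  have hadd: "h (x + y) = h x + h y" if "x \<ge> 0" "y \<ge> 0" for x y
    using add[OF that] by (simp add: h_def algebra_simps)
  have h0: "h 0 = 0" using hadd[of 0 0] by simp
  have h1: "h 1 = 0" by (simp add: h_def)
  have hmult: "h (real n * y) = real n * h y" if "y \<ge> 0" for n y
  proof (induction n)
    case (Suc n)
    have "h (real (Suc n) * y) = h (real n * y + y)" by (simp add: algebra_simps)
    also have "\<dots> = h (real n * y) + h y" using that by (intro hadd) auto
    finally show ?case using Suc by (simp add: algebra_simps)
  qed (simp add: h0)
  have bound01: "\<bar>h y\<bar> \<le> d 1" if "0 \<le> y" "y \<le> 1" for y
  proof -
    have "d 1 = d y + d (1 - y)" using add[of y "1 - y"] that by simp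
    then have "0 \<le> d y" "d y \<le> d 1" using pos[of y] pos[of "1 - y"] that by auto
    moreover have "0 \<le> y * d 1" "y * d 1 \<le> d 1"
      using that pos[of 1] by (auto intro: mult_left_le_one_le)
    ultimately show ?thesis by (auto simp: h_def)
  qed
  have bound: "\<bar>h y\<bar> \<le> d 1" if y: "y \<ge> 0" for y
  proof -
    define m where "m = nat \<lfloor>y\<rfloor>"
    have m: "real m = of_int \<lfloor>y\<rfloor>" using y by (simp add: m_def)
    have "0 \<le> y - real m" "y - real m \<le> 1" unfolding m by linarith+
    moreover have "h y = h (y - real m)"
      using hadd[of "y - real m" "real m"] hmult[of 1 m] h1 calculation by simp
    ultimately show ?thesis using bound01 by simp
  qed
  have "h x = 0"
  proof (rule ccontr)
    assume "h x \<noteq> 0"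
    then obtain n where "d 1 < real n * \<bar>h x\<bar>"
      using reals_Archimedean3[of "\<bar>h x\<bar>"] by auto
    moreover have "\<bar>real n * h x\<bar> \<le> d 1" using bound[of "real n * x"] x hmult[OF x, of n] by simp
    ultimately show False by (simp add: abs_mult)
  qed
  then show ?thesis by (simp add: h_def)
qed

lemma mixed_vol_commute: "mixed_vol K L = mixed_vol L K"
  by (simp add: mixed_vol_def msum_commute)

lemma mscale_in_K2: "K \<in> K2 \<Longrightarrow> mscale t K \<in> K2"
  by (auto simp: K2_def compact_mscale convex_mscale) (simp add: mscale_def)

lemma mixed_vol_mscale_right:
  assumes K: "K \<in> K2" and L: "L \<in> K2" and t: "t \<ge> 0"
  shows "mixed_vol K (mscale t L) = t * mixed_vol K L"
proof -
  define d where "d = (\<lambda>t. area (msum K (mscale t L)) - area K - t\<^sup>2 * area L)"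
  have V: "mixed_vol K (mscale t L) = d t / 2" for t
    by (simp add: mixed_vol_def d_def area_mscale)
  have K': "compact K" "convex K" "K \<noteq> {}" and L': "compact L" "convex L" "L \<noteq> {}"
    using K L by (auto simp: K2_def)
  \<comment> \<open>This is the vanishing second difference for \<open>hL\<close> and
    \<open>K + sL\<close>; the quadratic correction in \<open>d\<close> absorbs the term
    \<open>2 area (hL)\<close>.\<close>
  have jensen: "d (s + 2 * h) + d s = 2 * d (s + h)" if "s \<ge> 0" "h \<ge> 0" for s h
  proof -
    let ?M = "msum K (mscale s L)" and ?N = "mscale h L"
    have "?M \<noteq> {}" "?N \<noteq> {}" using K' L' by (auto simp: msum_def mscale_def)
    then have "second_diff ?M ?N = 0"
      by (intro second_diff_eq_0 compact_msum convex_msum compact_mscale convex_mscale K' L')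
    moreover have "msum ?N ?M = msum K (mscale (s + h) L)"
      using that msum_mscale_convex[OF L'(2), of s h] by (simp add: msum_commute[of ?N] msum_assoc)
    moreover have "msum (mscale 2 ?N) ?M = msum K (mscale (s + 2 * h) L)"
      using that msum_mscale_convex[OF L'(2), of s "2 * h"]
      by (simp add: mscale_mscale msum_commute[of "mscale (2 * h) L"] msum_assoc)
    ultimately show ?thesis
      by (simp add: second_diff_def d_def area_mscale power2_eq_square algebra_simps)
  qed
  have "mscale 0 L = {0}" using L' by (auto simp: mscale_def)
  then have d0: "d 0 = 0" by (simp add: d_def)
  have dbl: "d (2 * h) = 2 * d h" if "h \<ge> 0" for h
    using jensen[of 0 h] that d0 by simp
  \<comment> \<open>\<open>jensen\<close> with \<open>h = (y - x) / 2\<close> makes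
    \<open>d x + d y\<close> twice the value at the midpoint, and \<open>dbl\<close> turns this into
    \<open>d (x + y)\<close>.\<close>
  have le: "d (x + y) = d x + d y" if "x \<ge> 0" "x \<le> y" for x y
  proof -
    have "d y + d x = 2 * d (x + (y - x) / 2)"
    proof -
      have "x + 2 * ((y - x) / 2) = y" by (simp add: field_simps)
      then show ?thesis using jensen[of x "(y - x) / 2"] that by simp
    qed
    also have "\<dots> = d (2 * (x + (y - x) / 2))"
      using that by (intro dbl[symmetric]) simp
    also have "2 * (x + (y - x) / 2) = x + y" by (simp add: field_simps)
    finally show ?thesis by simp
  qed
  have "d (x + y) = d x + d y" if "x \<ge> 0" "y \<ge> 0" for x y
    using le[of x y] le[of y x] that by (cases "x \<le> y") (auto simp: add.commute)
  moreover have "d x \<ge> 0" for x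
    using mixed_vol_nonneg[OF K mscale_in_K2[OF L, of x]] V by simp
  ultimately have "d t = t * d 1" using t by (intro additive_nonneg_imp_linear) auto
  then have "mixed_vol K (mscale t L) = t * d 1 / 2" using V[of t] by simp
  also have "\<dots> = t * mixed_vol K L" using V[of 1] by simp
  finally show ?thesis .
qed

lemma mixed_vol_mscale:
  assumes "K \<in> K2" "L \<in> K2" "s \<ge> 0" "t \<ge> 0"
  shows "mixed_vol (mscale s K) (mscale t L) = s * t * mixed_vol K L"
proof -
  have "mixed_vol (mscale s K) (mscale t L) = t * mixed_vol L (mscale s K)"
    using assms mixed_vol_mscale_right[of "mscale s K" L t] by (simp add: mscale_in_K2 mixed_vol_commute)
  also have "\<dots> = t * (s * mixed_vol L K)"
    using assms mixed_vol_mscale_right[of L K s] by simp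
  finally show ?thesis by (simp add: mixed_vol_commute)
qed

section \<open>The fibres of the partition monomial map\<close>

lemma even_card_pair_partition:
  assumes "finite X" "even (card X)"
  shows "\<exists>P. (\<forall>I\<in>P. card I = 2) \<and> \<Union>P = X \<and> (\<forall>I\<in>P. \<forall>J\<in>P. I \<noteq> J \<longrightarrow> I \<inter> J = {})"
  using assms
proof (induction "card X" arbitrary: X rule: less_induct)
  case less
  show ?case
  proof (cases "X = {}")
    case True
    then show ?thesis by (intro exI[of _ "{}"]) auto
  next
    case False
    then have "card X \<noteq> 0" using less.prems by simp
    then have "2 \<le> card X" using less.prems(2) by (cases "card X = 1") auto
    then obtain I where I: "I \<subseteq> X" "card I = 2" by (meson obtain_subset_with_card_n)
    then have fI: "finite I" using less.prems finite_subset by blast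
    have c: "card (X - I) = card X - 2" using I fI by (simp add: card_Diff_subset)
    obtain P where P: "\<forall>I\<in>P. card I = 2" "\<Union>P = X - I" "\<forall>I\<in>P. \<forall>J\<in>P. I \<noteq> J \<longrightarrow> I \<inter> J = {}"
      using less.hyps[of "X - I"] c \<open>2 \<le> card X\<close> less.prems by auto
    show ?thesis
    proof (intro exI[of _ "insert I P"] conjI)
      show "\<Union> (insert I P) = X" using P I by auto
      show "\<forall>A\<in>insert I P. \<forall>B\<in>insert I P. A \<noteq> B \<longrightarrow> A \<inter> B = {}"
        using P by blast
    qed (use P I in auto)
  qed
qed

text \<open>\<open>P\<close> pairs off the complement of \<open>X\<close> and is fixed before the
  pairing \<open>Q\<close> of \<open>X\<close> is chosen, so different pairings of \<open>X\<close>
  can be compared with the same remainder.\<close>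

lemma pair_partition_complement:
  assumes "even n" "X \<subseteq> {1..n}" "even (card X)"
  obtains P where "finite P" "\<And>I. I \<in> P \<Longrightarrow> I \<inter> X = {}"
    "\<And>Q. Q \<subseteq> pairs n \<Longrightarrow> \<Union>Q = X \<Longrightarrow> (\<forall>I\<in>Q. \<forall>J\<in>Q. I \<noteq> J \<longrightarrow> I \<inter> J = {})
      \<Longrightarrow> Q \<union> P \<in> pair_partitions n"
    "P \<subseteq> pairs n"
proof -
  have "even (card ({1..n} - X))"
    using assms by (simp add: card_Diff_subset finite_subset)
  then obtain P where P: "\<forall>I\<in>P. card I = 2" "\<Union>P = {1..n} - X" "\<forall>I\<in>P. \<forall>J\<in>P. I \<noteq> J \<longrightarrow> I \<inter> J = {}"
    using even_card_pair_partition[of "{1..n} - X"] by auto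
  have Pn: "P \<subseteq> pairs n" using P by (auto simp: pairs_def)
  have "finite (\<Union>P)" unfolding P(2) by simp
  then have fP: "finite P" by (rule finite_UnionD)
  show ?thesis
  proof (rule that[OF fP _ _ Pn])
    show "I \<inter> X = {}" if "I \<in> P" for I using P(2) that by blast
    fix Q assume Q: "Q \<subseteq> pairs n" "\<Union>Q = X" "\<forall>I\<in>Q. \<forall>J\<in>Q. I \<noteq> J \<longrightarrow> I \<inter> J = {}"
    have "A \<inter> B = {}" if "A \<in> Q" "B \<in> P" for A B using that P(2) Q(2) by blast
    then have "\<forall>I\<in>Q \<union> P. \<forall>J\<in>Q \<union> P. I \<noteq> J \<longrightarrow> I \<inter> J = {}"
      using P(3) Q(3) by (metis Int_commute Un_iff)
    then show "Q \<union> P \<in> pair_partitions n"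
      using Q P(2) Pn assms(2) by (auto simp: pair_partitions_def)
  qed
qed

text \<open>Both pairings of the four indices extend to partitions by the same \<open>P\<close>,
  whose positive product cancels.\<close>

lemma pair_partition_exchange:
  fixes w :: "nat set \<Rightarrow> real"
  assumes n: "even n" and pos: "\<And>I. I \<in> pairs n \<Longrightarrow> w I > 0"
    and prod: "\<And>P. P \<in> pair_partitions n \<Longrightarrow> (\<Prod>I\<in>P. w I) = 1"
    and ijkl: "i \<in> {1..n}" "j \<in> {1..n}" "k \<in> {1..n}" "l \<in> {1..n}" "distinct [i, j, k, l]"
  shows "w {i, j} * w {k, l} = w {i, k} * w {j, l}"
proof -
  have "{i, j, k, l} \<subseteq> {1..n}" "even (card {i, j, k, l})" using ijkl by auto
  then obtain P where P: "finite P" "\<And>I. I \<in> P \<Longrightarrow> I \<inter> {i, j, k, l} = {}"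
    "\<And>Q. Q \<subseteq> pairs n \<Longrightarrow> \<Union>Q = {i, j, k, l} \<Longrightarrow> (\<forall>I\<in>Q. \<forall>J\<in>Q. I \<noteq> J \<longrightarrow> I \<inter> J = {})
      \<Longrightarrow> Q \<union> P \<in> pair_partitions n"
    "P \<subseteq> pairs n"
    by (rule pair_partition_complement[OF n]) blast
  have *: "w {a, b} * w {c, d} * prod w P = 1"
    if eq: "{a, b, c, d} = {i, j, k, l}" and dist: "distinct [a, b, c, d]" for a b c d
  proof -
    have "{{a, b}, {c, d}} \<union> P \<in> pair_partitions n"
    proof (rule P(3))
      show "{{a, b}, {c, d}} \<subseteq> pairs n"
        using eq dist \<open>{i, j, k, l} \<subseteq> {1..n}\<close> by (auto simp: pairs_def)
      show "\<Union>{{a, b}, {c, d}} = {i, j, k, l}" unfolding eq[symmetric] by auto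
      show "\<forall>I\<in>{{a, b}, {c, d}}. \<forall>J\<in>{{a, b}, {c, d}}. I \<noteq> J \<longrightarrow> I \<inter> J = {}"
        using dist by simp
    qed
    then have "prod w ({{a, b}, {c, d}} \<union> P) = 1" by (rule prod)
    moreover have "{a, b} \<notin> P" "{c, d} \<notin> P"
      using P(2)[of "{a, b}", folded eq] P(2)[of "{c, d}", folded eq] by auto
    moreover have "{a, b} \<noteq> {c, d}" using dist by auto
    ultimately show ?thesis using P(1) by (simp add: mult.assoc)
  qed
  have "prod w P > 0" using P(4) pos by (intro prod_pos) auto
  moreover have "w {i, j} * w {k, l} * prod w P = w {i, k} * w {j, l} * prod w P"
    using *[of i j k l] *[of i k j l] ijkl(5) by (simp add: insert_commute)
  ultimately show ?thesis by simp
qed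

text \<open>If \<open>w_ij = c_i c_j\<close>, then \<open>w_1i w_1k / w_ik\<close> is the square of
  \<open>c_1\<close> for all \<open>i\<close> and \<open>k\<close>. Conversely the exchange relation
  makes this quotient a constant \<open>q\<close>, which determines all factors.\<close>

lemma pair_partition_factor:
  fixes w :: "nat set \<Rightarrow> real"
  assumes n: "n \<ge> 2" "even n" and pos: "\<And>I. I \<in> pairs n \<Longrightarrow> w I > 0"
    and prod: "\<And>P. P \<in> pair_partitions n \<Longrightarrow> (\<Prod>I\<in>P. w I) = 1"
  obtains c where "\<And>i. i \<in> {1..n} \<Longrightarrow> c i > 0"
    "\<And>i j. i \<in> {1..n} \<Longrightarrow> j \<in> {1..n} \<Longrightarrow> i \<noteq> j \<Longrightarrow> w {i, j} = c i * c j"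
proof (cases "n = 2")
  case True
  have ij: "{i, j} = {1..n}" if "i \<in> {1..n}" "j \<in> {1..n}" "i \<noteq> j" for i j
    using that True by auto
  \<comment> \<open>For \<open>n = 2\<close> the single block is itself a partition, so its weight
    is 1 and all factors can be 1.\<close>
  have "{{1..n}} \<in> pair_partitions n"
    using True by (auto simp: pair_partitions_def pairs_def)
  then have "w {1..n} = 1" using prod by fastforce
  then show ?thesis using that[of "\<lambda>_. 1"] ij by simp
next
  case False
  then have n4: "n \<ge> 4" using n by presburger
  have wp: "w {i, j} > 0" if "i \<in> {1..n}" "j \<in> {1..n}" "i \<noteq> j" for i j
    using that by (intro pos) (auto simp: pairs_def)
  have change: "w {1, i} * w {1, k} / w {i, k} = w {1, i} * w {1, l} / w {i, l}"
    if "i \<in> {2..n}" "k \<in> {2..n}" "l \<in> {2..n}" "i \<noteq> k" "i \<noteq> l" for i k l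
  proof (cases "k = l")
    case False
    have "w {1, k} * w {i, l} = w {1, l} * w {i, k}"
      using pair_partition_exchange[OF n(2) pos prod, of 1 k l i] that False by (auto simp: insert_commute)
    then show ?thesis using wp[of i k] wp[of i l] that by (simp add: field_simps)
  qed simp
  define q where "q = w {1, 2} * w {1, 3} / w {2, 3}"
  \<comment> \<open>\<open>change\<close> replaces one index at a time: \<open>(i, k)\<close>
    becomes \<open>(i, 2)\<close>, by symmetry \<open>(2, i)\<close>, and then
    \<open>(2, 3)\<close>.\<close>
  have q: "w {1, i} * w {1, k} / w {i, k} = q" if "i \<in> {2..n}" "k \<in> {2..n}" "i \<noteq> k" for i k
  proof (cases "i = 2")
    case True
    then show ?thesis using change[of 2 k 3] that n4 by (simp add: q_def)
  next
    case False
    have "w {1, i} * w {1, k} / w {i, k} = w {1, i} * w {1, 2} / w {i, 2}"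
      using change[of i k 2] that False n4 by auto
    also have "\<dots> = w {1, 2} * w {1, i} / w {2, i}" by (simp add: insert_commute mult.commute)
    also have "\<dots> = q" using change[of 2 i 3] that False n4 by (simp add: q_def)
    finally show ?thesis .
  qed
  have qpos: "q > 0" using wp[of 1 2] wp[of 1 3] wp[of 2 3] n4 by (simp add: q_def)
  define c where "c = (\<lambda>i. if i = 1 then sqrt q else w {1, i} / sqrt q)"
  show ?thesis
  proof (rule that[of c])
    show "c i > 0" if "i \<in> {1..n}" for i
      using qpos wp[of 1 i] that by (auto simp: c_def)
    fix i j assume ij: "i \<in> {1..n}" "j \<in> {1..n}" "i \<noteq> j"
    consider "i = 1" | "j = 1" | "i \<noteq> 1" "j \<noteq> 1" by blast
    then show "w {i, j} = c i * c j"
    proof cases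
      case 3
      then have "w {1, i} * w {1, j} = q * w {i, j}"
        using q[of i j] ij wp[of i j] by (auto simp: field_simps)
      moreover have "c i * c j = w {1, i} * w {1, j} / q"
        using 3 qpos by (simp add: c_def)
      ultimately show ?thesis using qpos by simp
    qed (use ij qpos in \<open>auto simp: c_def insert_commute\<close>)
  qed
qed

theorem theorem3p1:
  fixes n :: nat and A :: "(real^2) set set" and x :: "nat set \<Rightarrow> real"
  assumes "n \<ge> 2" and "even n"
    and "A \<subseteq> K2"
    and "\<And>K L a b. K \<in> A \<Longrightarrow> L \<in> A \<Longrightarrow> a > 0 \<Longrightarrow> b > 0 \<Longrightarrow>
           msum (mscale a K) (mscale b L) \<in> A"
    and "\<forall>I\<in>pairs n. x I > 0"
    and "\<forall>I. I \<notin> pairs n \<longrightarrow> x I = 0"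
  shows "x \<in> PVspace n A \<longleftrightarrow> phi n x \<in> phi n ` PVspace n A"
proof
  assume "phi n x \<in> phi n ` PVspace n A"
  then obtain K where K: "\<And>i. i \<in> {1..n} \<Longrightarrow> K i \<in> A" and phi: "phi n x = phi n (PV n K)"
    unfolding PVspace_def by blast
  define y where "y = PV n K"
  \<comment> \<open>\<open>PV\<close> reads an unordered pair through its minimum and maximum; these
    facts translate back to \<open>{i, j}\<close>.\<close>
  have MinMax: "Min I \<in> {1..n}" "Max I \<in> {1..n}" "Min I \<noteq> Max I" "{Min I, Max I} = I" if "I \<in> pairs n" for I
  proof -
    obtain i j where ij: "I = {i, j}" "i \<noteq> j" using \<open>I \<in> pairs n\<close> by (auto simp: pairs_def card_2_iff)
    show "Min I \<in> {1..n}" "Max I \<in> {1..n}" "Min I \<noteq> Max I" "{Min I, Max I} = I"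
      using ij \<open>I \<in> pairs n\<close> by (auto simp: pairs_def min_def max_def)
  qed
  have prod_eq: "prod x P = prod y P" if "P \<in> pair_partitions n" for P
    using fun_cong[OF phi, of P] that by (simp add: phi_def y_def)
  have fin: "finite P" if "P \<in> pair_partitions n" for P
  proof -
    have "\<Union>P = {1..n}" using that by (auto simp: pair_partitions_def)
    then show ?thesis by (metis finite_UnionD finite_atLeastAtMost)
  qed
  \<comment> \<open>A zero coordinate of \<open>y\<close> would annihilate the monomial of a
    partition containing \<open>I\<close>, whereas the same monomial of \<open>x\<close> is
    positive.\<close>
  have ypos: "y I > 0" if I: "I \<in> pairs n" for I
  proof -
    have "y I \<ge> 0"
      using I K MinMax[OF I] assms(3) by (auto simp: y_def PV_def intro!: mixed_vol_nonneg)
    moreover have "y I \<noteq> 0"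
    proof
      assume y0: "y I = 0"
      have "I \<subseteq> {1..n}" "even (card I)" using I by (auto simp: pairs_def)
      then obtain P where "\<And>Q. Q \<subseteq> pairs n \<Longrightarrow> \<Union>Q = I \<Longrightarrow> (\<forall>I\<in>Q. \<forall>J\<in>Q. I \<noteq> J \<longrightarrow> I \<inter> J = {})
      \<Longrightarrow> Q \<union> P \<in> pair_partitions n"
        using pair_partition_complement[OF assms(2)] by metis
      from this[of "{I}"] I have P: "{I} \<union> P \<in> pair_partitions n" by auto
      have "prod y ({I} \<union> P) = 0" using y0 fin[OF P] by auto
      moreover have "prod x ({I} \<union> P) > 0"
        using P assms(5) by (intro prod_pos) (auto simp: pair_partitions_def)
      ultimately show False using prod_eq[OF P] by simp
    qed
    ultimately show ?thesis by simp
  qed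
  obtain c where c: "\<And>i. i \<in> {1..n} \<Longrightarrow> c i > 0"
    "\<And>i j. i \<in> {1..n} \<Longrightarrow> j \<in> {1..n} \<Longrightarrow> i \<noteq> j \<Longrightarrow> x {i, j} / y {i, j} = c i * c j"
  proof (rule pair_partition_factor[OF assms(1,2), of "\<lambda>I. x I / y I"])
    show "x I / y I > 0" if "I \<in> pairs n" for I using that ypos assms(5) by simp
    show "(\<Prod>I\<in>P. x I / y I) = 1" if P: "P \<in> pair_partitions n" for P
    proof -
      have "prod y P > 0" using P ypos by (intro prod_pos) (auto simp: pair_partitions_def)
      then show ?thesis using prod_eq[OF P] by (simp add: prod_dividef)
    qed
  qed blast
  define K' where "K' = (\<lambda>i. mscale (c i) (K i))"
  \<comment> \<open>Closure of \<open>A\<close> concerns sums of two positively scaled bodies, so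
    the rescaled body is written as the sum of two equal halves, by convexity.\<close>
  have "K' i \<in> A" if i: "i \<in> {1..n}" for i
  proof -
    have "msum (mscale (c i / 2) (K i)) (mscale (c i / 2) (K i)) \<in> A"
      using i K c by (intro assms(4)) auto
    moreover have "convex (K i)" using K[OF i] assms(3) by (auto simp: K2_def)
    ultimately show ?thesis
      using msum_mscale_convex[of "K i" "c i / 2" "c i / 2"] c(1)[OF i] by (simp add: K'_def)
  qed
  moreover have "x = PV n K'"
  proof
    fix I
    show "x I = PV n K' I"
    proof (cases "I \<in> pairs n")
      case True
      note M = MinMax[OF True]
      \<comment> \<open>By homogeneity the rescaling multiplies \<open>y I\<close> by the two
        factors, whose product is \<open>x I / y I\<close>.\<close>
      have "PV n K' I = c (Min I) * c (Max I) * y I"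
        using True M c(1) K assms(3)
        by (auto simp: PV_def K'_def y_def less_imp_le intro!: mixed_vol_mscale)
      also have "\<dots> = x I" using c(2)[OF M(1,2,3)] M(4) ypos[OF True] by (simp add: field_simps)
      finally show ?thesis by simp
    next
      case False
      then show ?thesis using assms(6) by (simp add: PV_def)
    qed
  qed
  ultimately show "x \<in> PVspace n A" by (auto simp: PVspace_def)
qed auto

end
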